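(* Let $p$ be a prime and let $S$ be a nontrivial subtree of $T_p$ which is rooted at $\epsilon$. The following properties are equivalent: (1) $S$ is a tile in some tiling of $T_p$. (2) The balls $\{\mathbb{B}_\ell : \ell\in L(S)\}$ form a partition of $\mathbb{Z}_p$.
   Context: $\Sigma_p=\{0,1,\dots,p-1\}$ and $\Sigma_p^*$ is the monoid of finite words over $\Sigma_p$ under concatenation, with identity the empty word $\epsilon$; $|w|$ is the length of $w$. The full infinite $p$-ary rooted tree $T_p$ has vertex set $V(T_p)=\Sigma_p^*$, root $\epsilon$, and edges $(w,wc)$ for $w\in\Sigma_p^*$, $c\in\Sigma_p$; the children of $w$ are the words $wc$. A subtree $S$ of $T_p$ is a connected subgraph, with vertex set $V(S)$ and edge set $E(S)$; it is nontrivial if $E(S)\ne\varnothing$, and rooted at $\epsilon$ if $\epsilon\in V(S)$. $L(S)$ denotes the set of leaves of $S$, i.e. nodes of $S$ having no children in $S$. $\Sigma_p^*$ acts on $T_p$ by left translation: $\omega\cdot v=\omega v$ on vertices and $\omega(v,v')=(\omega v,\omega v')$ on edges; $\omega S$ is the translate of $S$. A tiling of $T_p$ is a pair $(S,\Omega)$ where $S$ (the tile) is a nontrivial finite subtree of $T_p$ and $\Omega\subseteq\Sigma_p^*$ is a subset such that: every vertex of $T_p$ is of the form $\omega s$ with $\omega\in\Omega$, $s\in V(S)$; every edge of $T_p$ is of the form $\omega e$ with $\omega\in\Omega$, $e\in E(S)$; and for distinct $\omega,\omega'\in\Omega$ the subgraphs $\omega S$ and $\omega' S$ have no common edge. For $w=a_0a_1\cdots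 a_{n-1}\in\Sigma_p^*$ put $N(w)=a_0+a_1p+\cdots+a_{n-1}p^{n-1}$ and let $\mathbb{B}_w=B(N(w),p^{-|w|+1})=\{x\in\mathbb{Z}_p : |x-N(w)|_p<p^{-|w|+1}\}$ be the associated $p$-adic ball, with $\mathbb{B}_\epsilon=\mathbb{Z}_p$. A partition is a subdivision into pairwise disjoint nonempty subsets; that the balls form a partition means that $\mathbb{B}_\ell$, $\ell\in L(S)$, are pairwise disjoint for distinct leaves and their union is $\mathbb{Z}_p$. *)

theory Defs
  imports
    Complex_Main
    "HOL-Computational_Algebra.Primes"
    "HOL-Library.Disjoint_Sets"
    "Graph_Theory.Digraph_Component"
begin

section \<open>The tree of finite words\<close>

abbreviation words :: "nat \<Rightarrow> nat list set" where
  "words p \<equiv> lists {..<p}"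

text \<open>
  Edges are represented as arcs directed away from the root.  The constant \<^const>\<open>connected\<close>
  of the graph library refers to the symmetric closure and includes nonemptiness.
\<close>

definition word_tree :: "nat \<Rightarrow> nat list pair_pre_digraph" where
  "word_tree p = \<lparr> pverts = words p, parcs = {(w, w @ [c]) | w c. w \<in> words p \<and> c < p} \<rparr>"

definition is_subtree :: "nat \<Rightarrow> nat list pair_pre_digraph \<Rightarrow> bool" where
  "is_subtree p S \<longleftrightarrow> subgraph (with_proj S) (with_proj (word_tree p)) \<and> connected (with_proj S)"

definition nontrivial :: "nat list pair_pre_digraph \<Rightarrow> bool" where
  "nontrivial S \<longleftrightarrow> parcs S \<noteq> {}"

definition rooted :: "nat list pair_pre_digraph \<Rightarrow> bool" where
  "rooted S \<longleftrightarrow> [] \<in> pverts S"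

definition leaves :: "nat list pair_pre_digraph \<Rightarrow> nat list set" where
  "leaves S = {v \<in> pverts S. \<forall>c. (v, v @ [c]) \<notin> parcs S}"

section \<open>Tilings\<close>

definition translate :: "nat list \<Rightarrow> nat list pair_pre_digraph \<Rightarrow> nat list pair_pre_digraph" where
  "translate \<omega> S = \<lparr> pverts = (\<lambda>v. \<omega> @ v) ` pverts S,
                     parcs = (\<lambda>(v, v'). (\<omega> @ v, \<omega> @ v')) ` parcs S \<rparr>"

definition is_tiling :: "nat \<Rightarrow> nat list pair_pre_digraph \<Rightarrow> nat list set \<Rightarrow> bool" where
  "is_tiling p S \<Omega> \<longleftrightarrow>
     is_subtree p S \<and> nontrivial S \<and> finite (pverts S) \<and> \<Omega> \<subseteq> words p \<and>
     (\<forall>v \<in> pverts (word_tree p). \<exists>\<omega> \<in> \<Omega>. v \<in> pverts (translate \<omega> S)) \<and>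
     (\<forall>e \<in> parcs (word_tree p). \<exists>\<omega> \<in> \<Omega>. e \<in> parcs (translate \<omega> S)) \<and>
     (\<forall>\<omega> \<in> \<Omega>. \<forall>\<omega>' \<in> \<Omega>. \<omega> \<noteq> \<omega>' \<longrightarrow> parcs (translate \<omega> S) \<inter> parcs (translate \<omega>' S) = {})"

section \<open>The $p$-adic integers\<close>

text \<open>
  \<open>\<int>\<^sub>p\<close> is the inverse limit of the rings \<open>\<int>/p\<^sup>n\<int>\<close>: the \<open>n\<close>-th entry of a sequence is the
  least nonnegative representative of the residue modulo \<open>p\<^sup>n\<close>.
\<close>

definition padic_ints :: "nat \<Rightarrow> (nat \<Rightarrow> int) set" where
  "padic_ints p = {x. \<forall>n. x n \<in> {0..<int p ^ n} \<and> x (Suc n) mod int p ^ n = x n}"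

definition padic_of_int :: "nat \<Rightarrow> int \<Rightarrow> nat \<Rightarrow> int" where
  "padic_of_int p k = (\<lambda>n. k mod int p ^ n)"

definition padic_diff :: "nat \<Rightarrow> (nat \<Rightarrow> int) \<Rightarrow> (nat \<Rightarrow> int) \<Rightarrow> nat \<Rightarrow> int" where
  "padic_diff p x y = (\<lambda>n. (x n - y n) mod int p ^ n)"

text \<open>
  For a nonzero \<open>x\<close>, the valuation is the largest \<open>n\<close> such that \<open>x\<close> vanishes modulo \<open>p\<^sup>n\<close>,
  that is, the least \<open>n\<close> such that \<open>x\<close> does not vanish modulo \<open>p\<^bsup>n+1\<^esup>\<close>.
\<close>

definition padic_val :: "(nat \<Rightarrow> int) \<Rightarrow> nat" where
  "padic_val x = (LEAST n. x (Suc n) \<noteq> 0)"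

definition padic_abs :: "nat \<Rightarrow> (nat \<Rightarrow> int) \<Rightarrow> real" where
  "padic_abs p x = (if x = (\<lambda>n. 0) then 0 else real p powi (- int (padic_val x)))"

definition padic_ball :: "nat \<Rightarrow> (nat \<Rightarrow> int) \<Rightarrow> real \<Rightarrow> (nat \<Rightarrow> int) set" where
  "padic_ball p a r = {x \<in> padic_ints p. padic_abs p (padic_diff p x a) < r}"

definition word_value :: "nat \<Rightarrow> nat list \<Rightarrow> nat" where
  "word_value p w = (\<Sum>i<length w. w ! i * p ^ i)"

text \<open>For the empty word the radius is \<open>p\<close>, so that the ball is all of \<open>\<int>\<^sub>p\<close>.\<close>

definition word_ball :: "nat \<Rightarrow> nat list \<Rightarrow> (nat \<Rightarrow> int) set" where
  "word_ball p w = padic_ball p (padic_of_int p (int (word_value p w))) (real p powi (1 - int (length w)))"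

definition forms_partition :: "('i \<Rightarrow> 'a set) \<Rightarrow> 'i set \<Rightarrow> 'a set \<Rightarrow> bool" where
  "forms_partition B I X \<longleftrightarrow>
     (\<forall>i \<in> I. B i \<noteq> {}) \<and> disjoint_family_on B I \<and> (\<Union>i \<in> I. B i) = X"

end

theory Submission
  imports Defs "HOL-Library.Sublist"
begin

text \<open>
  Both properties say that \<open>S\<close> is finite and \<open>full\<close>: a vertex of \<open>S\<close> has either none
  or all of its $p$ children in \<open>S\<close>.

  On the $p$-adic side, the ball of a word consists of the $p$-adic integers whose digit expansion begins
  with this word (\<open>mem_word_ball_iff\<close>).  Two such balls meet only if one word is a prefix of the other, so
  balls of different leaves are disjoint for every \<open>S\<close>, and the partition property is about covering.
  If \<open>S\<close> is finite and full, then the digits of any $p$-adic integer lead from the root to a leaf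
  (\<open>finite_full_imp_partition\<close>).  Conversely, a missing child of an inner vertex leaves a whole ball
  uncovered (\<open>cover_imp_full\<close>), and an infinite branch of \<open>S\<close>, which exists by Koenig's lemma if
  \<open>S\<close> is infinite, spells out an uncovered point (\<open>cover_imp_finite\<close>).

  On the tiling side, the root is covered only by the untranslated tile, so the tile contains all $p$
  arcs at the root, and so does each of its translates at the root of that translate.  A translate
  that supplied an arc missing at an inner vertex of \<open>S\<close> would therefore share one of its root arcs with
  \<open>S\<close> (\<open>tiling_imp_full\<close>).  Conversely, if \<open>S\<close> is finite and full, then the translates
  by all concatenations of leaves form a tiling: a word is read by repeatedly running through \<open>S\<close>
  from the root and restarting at each leaf, and this reading is unambiguous because the leaves form a
  prefix code (\<open>full_imp_tiling\<close>).
\<close>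

section \<open>Digit words of $p$-adic integers\<close>

definition digits :: "nat \<Rightarrow> (nat \<Rightarrow> int) \<Rightarrow> nat \<Rightarrow> nat list" where
  "digits p x n = map (\<lambda>i. nat (x (Suc i) div int p ^ i)) [0..<n]"

lemma length_digits [simp]: "length (digits p x n) = n"
  by (simp add: digits_def)

lemma digits_0 [simp]: "digits p x 0 = []"
  by (simp add: digits_def)

lemma take_digits: "m \<le> n \<Longrightarrow> take m (digits p x n) = digits p x m"
  by (simp add: digits_def take_map)

lemma prefix_digits: "m \<le> n \<Longrightarrow> prefix (digits p x m) (digits p x n)"
  by (metis take_digits take_is_prefix)

lemma word_value_Nil [simp]: "word_value p [] = 0"
  by (simp add: word_value_def)

lemma word_value_snoc: "word_value p (w @ [c]) = word_value p w + c * p ^ length w"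
  by (simp add: word_value_def nth_append)

lemma word_value_less:
  assumes "w \<in> words p"
  shows "word_value p w < p ^ length w"
  using assms
proof (induction w rule: rev_induct)
  case (snoc c w)
  then have "word_value p w < p ^ length w" and "Suc c \<le> p" by auto
  moreover from this have "Suc c * p ^ length w \<le> p * p ^ length w" by (intro mult_right_mono) auto
  ultimately show ?case by (simp add: word_value_snoc)
qed simp

lemma word_value_inj:
  assumes "length u = length v" "u \<in> words p" "v \<in> words p" "word_value p u = word_value p v"
  shows "u = v"
  using assms
proof (induction u arbitrary: v rule: rev_induct)
  case (snoc c u)
  then obtain d w where v: "v = w @ [d]" by (cases v rule: rev_cases) auto
  let ?q = "p ^ length u"
  have len: "length w = length u" using snoc.prems v by simp
  have small: "word_value p u < ?q" "word_value p w < ?q"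
    using snoc.prems v len word_value_less[of u p] word_value_less[of w p] by auto
  have eq: "word_value p u + c * ?q = word_value p w + d * ?q"
    using snoc.prems v len by (simp add: word_value_snoc)
  from arg_cong[OF eq, of "\<lambda>n. n mod ?q"] small have "word_value p u = word_value p w" by simp
  moreover from this eq small have "c = d" by (metis add_left_cancel mult_right_cancel not_less_zero)
  ultimately show ?case using snoc v len by auto
qed simp

lemma padic_ints_mod:
  assumes "x \<in> padic_ints p" "m \<le> n"
  shows "x n mod int p ^ m = x m"
  using assms(2)
proof (induction n rule: dec_induct)
  case base
  then show ?case using assms(1) by (simp add: padic_ints_def)
next
  case (step n)
  have "x (Suc n) mod int p ^ m = x (Suc n) mod int p ^ n mod int p ^ m"
    using step.hyps by (simp add: mod_mod_cancel le_imp_power_dvd)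
  then show ?case using assms(1) step by (simp add: padic_ints_def)
qed

text \<open>
  The residues $x_n$ and $x_{n+1}$ modulo consecutive powers differ by $d p^n$ with $0 \le d < p$, and this
  $d$ is the quotient $\lfloor x_{n+1} / p^n \rfloor$ because $0 \le x_n < p^n$.
\<close>

lemma digits_of_padic_int:
  assumes "x \<in> padic_ints p"
  shows "digits p x n \<in> words p \<and> int (word_value p (digits p x n)) = x n"
proof (induction n)
  case 0
  have "x 0 \<in> {0..<int p ^ 0}" using assms unfolding padic_ints_def by blast
  then show ?case by simp
next
  case (Suc n)
  define d where "d = x (Suc n) div int p ^ n"
  have range: "x (Suc n) \<in> {0..<int p ^ Suc n}" and compat: "x (Suc n) mod int p ^ n = x n"
    using assms unfolding padic_ints_def by blast+
  have p: "0 < int p" using range by (cases "p = 0") auto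
  have x_Suc: "x (Suc n) = x n + d * int p ^ n"
    unfolding d_def using compat by (metis add.commute div_mult_mod_eq)
  have "0 \<le> x n" using compat p by (metis pos_mod_sign zero_less_power)
  then have "d * int p ^ n < int p * int p ^ n" using x_Suc range by simp
  then have d: "0 \<le> d" "d < int p"
    using p range by (simp_all add: d_def pos_imp_zdiv_nonneg_iff)
  have snoc: "digits p x (Suc n) = digits p x n @ [nat d]"
    by (simp add: digits_def d_def)
  show ?case using Suc d x_Suc by (auto simp: snoc word_value_snoc)
qed

lemma digits_eq_iff:
  assumes "x \<in> padic_ints p" "w \<in> words p"
  shows "digits p x (length w) = w \<longleftrightarrow> x (length w) = int (word_value p w)"
proof
  show "x (length w) = int (word_value p w)" if "digits p x (length w) = w"
    using digits_of_padic_int[OF assms(1), of "length w"] that by simp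
  show "digits p x (length w) = w" if "x (length w) = int (word_value p w)"
    using digits_of_padic_int[OF assms(1), of "length w"] that assms(2)
    by (intro word_value_inj[of _ _ p]) auto
qed

text \<open>
  The nonzero values of $|x - k|_p$ are the powers $p^{-m}$ with $m \ge 0$, where $m$ is the largest exponent with
  $x \equiv k$ modulo $p^m$.  So the strict inequality $|x - k|_p < p^{1-n}$ means that $m \ge n$.
\<close>

lemma padic_ball_of_int_iff:
  assumes "1 < p" "x \<in> padic_ints p"
  shows "x \<in> padic_ball p (padic_of_int p k) (real p powi (1 - int n)) \<longleftrightarrow> x n = k mod int p ^ n"
proof -
  define y where "y = padic_diff p x (padic_of_int p k)"
  have y_zero: "y m = 0 \<longleftrightarrow> x m = k mod int p ^ m" for m
  proof -
    have "x m mod int p ^ m = x m" using padic_ints_mod[OF assms(2)] by blast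
    then show ?thesis
      by (simp add: y_def padic_diff_def padic_of_int_def mod_eq_0_iff_dvd flip: mod_eq_dvd_iff)
  qed
  have y_down: "y m = 0" if "y n = 0" "m \<le> n" for m n
  proof -
    have "x m = k mod int p ^ n mod int p ^ m"
      using padic_ints_mod[OF assms(2) \<open>m \<le> n\<close>] that(1) y_zero by metis
    then show ?thesis using that(2) by (simp add: y_zero mod_mod_cancel le_imp_power_dvd)
  qed
  have y_0: "y 0 = 0" by (simp add: y_def padic_diff_def)
  have "padic_abs p y < real p powi (1 - int n) \<longleftrightarrow> y n = 0"
  proof (cases "y = (\<lambda>n. 0)")
    case True
    then show ?thesis using assms(1) by (simp add: padic_abs_def)
  next
    case False
    then obtain j where "y j \<noteq> 0" by auto
    with y_0 obtain i where i: "y (Suc i) \<noteq> 0" by (cases j) auto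
    define L where "L = padic_val y"
    have L: "y (Suc L) \<noteq> 0" unfolding L_def padic_val_def using i by (rule LeastI)
    have below: "y m = 0" if "m \<le> L" for m
      using that not_less_Least[of "m - 1" "\<lambda>n. y (Suc n) \<noteq> 0"] y_0
      by (cases m) (auto simp: L_def padic_val_def)
    have "padic_abs p y < real p powi (1 - int n) \<longleftrightarrow> - int L < 1 - int n"
      using assms(1) False power_int_strict_increasing[of "- int L" "1 - int n" "real p"]
        power_int_increasing[of "1 - int n" "- int L" "real p"]
      by (auto simp: padic_abs_def L_def simp flip: not_le)
    also have "\<dots> \<longleftrightarrow> n \<le> L" by auto
    also have "\<dots> \<longleftrightarrow> y n = 0"
      using below[of n] y_down[of n "Suc L"] L by force
    finally show ?thesis .
  qed
  then show ?thesis using assms(2) by (simp add: padic_ball_def y_def[symmetric] y_zero)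
qed

lemma mem_word_ball_iff:
  assumes "1 < p" "w \<in> words p"
  shows "x \<in> word_ball p w \<longleftrightarrow> x \<in> padic_ints p \<and> digits p x (length w) = w"
proof (cases "x \<in> padic_ints p")
  case True
  have "int (word_value p w) mod int p ^ length w = int (word_value p w)"
    using word_value_less[OF assms(2)] by (simp flip: of_nat_power of_nat_mod)
  then show ?thesis
    using True padic_ball_of_int_iff[OF assms(1) True] digits_eq_iff[OF True assms(2)]
    by (simp add: word_ball_def)
qed (simp add: word_ball_def padic_ball_def)

lemma padic_of_int_in_padic_ints: "0 < p \<Longrightarrow> padic_of_int p k \<in> padic_ints p"
  by (auto simp: padic_ints_def padic_of_int_def mod_mod_cancel)

lemma word_ball_nonempty:
  assumes "1 < p" "w \<in> words p"
  shows "word_ball p w \<noteq> {}"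
proof -
  let ?x = "padic_of_int p (int (word_value p w))"
  have "?x \<in> padic_ints p" using assms(1) by (intro padic_of_int_in_padic_ints) simp
  then have "?x \<in> word_ball p w"
    unfolding word_ball_def using padic_ball_of_int_iff[OF assms(1)] by (simp add: padic_of_int_def)
  then show ?thesis by blast
qed

lemma word_balls_meet_imp_comparable:
  assumes "1 < p" "u \<in> words p" "v \<in> words p" "x \<in> word_ball p u" "x \<in> word_ball p v"
  shows "prefix u v \<or> prefix v u"
proof -
  have "digits p x (length u) = u" "digits p x (length v) = v"
    using assms mem_word_ball_iff by auto
  then show ?thesis
    using prefix_digits[of "length u" "length v" p x] prefix_digits[of "length v" "length u" p x]
    by (metis nat_le_linear)
qed

section \<open>Rooted subtrees\<close>

locale rooted_subtree =
  fixes p :: nat and S :: "nat list pair_pre_digraph"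
  assumes subtree: "is_subtree p S" and rooted: "rooted S"
begin

lemma verts_words: "pverts S \<subseteq> words p"
  using subtree by (simp add: is_subtree_def subgraph_def word_tree_def)

lemma root_vert: "[] \<in> pverts S"
  using rooted by (simp add: rooted_def)

lemma arc_cases:
  assumes "(u, v) \<in> parcs S"
  obtains c where "v = u @ [c]" "u \<in> pverts S" "v \<in> pverts S"
proof -
  have arc: "(u, v) \<in> parcs (word_tree p)" and wf: "pair_wf_digraph S"
    using assms subtree by (auto simp: is_subtree_def subgraph_def wf_digraph_wp_iff)
  from arc obtain c where "v = u @ [c]" by (auto simp: word_tree_def)
  then show thesis
    using pair_wf_digraph.in_arcsD1[OF wf assms] pair_wf_digraph.in_arcsD2[OF wf assms] by (rule that)
qed

text \<open>
  Connectedness is undirected, so a walk from the root may go up and down.  The property that the whole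
  branch from the root belongs to the subtree survives steps in both directions.
\<close>

lemma branch_in_subtree:
  assumes "v \<in> pverts S" "prefix (w @ [c]) v"
  shows "(w, w @ [c]) \<in> parcs S"
proof -
  let ?G = "mk_symmetric (with_proj S)"
  have wf: "wf_digraph (with_proj ?G)"
    using subtree wf_digraph.wellformed_mk_symmetric wf_digraph_wp_iff
    by (auto simp: is_subtree_def subgraph_def)
  have "[] \<rightarrow>\<^sup>*\<^bsub>with_proj ?G\<^esub> v"
    using subtree assms(1) root_vert
    by (simp add: is_subtree_def connected_def strongly_connected_def)
  with wf have "\<forall>w c. prefix (w @ [c]) v \<longrightarrow> (w, w @ [c]) \<in> parcs S"
  proof (induction rule: wf_digraph.reachable_induct[consumes 2, case_names base step])
    case (step x y)
    then have "(x, y) \<in> parcs S \<or> (y, x) \<in> parcs S"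
      by (auto simp: parcs_mk_symmetric)
    then show ?case
    proof
      assume xy: "(x, y) \<in> parcs S"
      then obtain d where "y = x @ [d]" by (rule arc_cases)
      then show ?thesis using xy step.IH by auto
    next
      assume "(y, x) \<in> parcs S"
      then obtain d where "x = y @ [d]" by (rule arc_cases)
      then show ?thesis using step.IH by auto
    qed
  qed simp
  then show ?thesis using assms(2) by blast
qed

lemma arc_iff: "(w, w @ [c]) \<in> parcs S \<longleftrightarrow> w @ [c] \<in> pverts S"
  using branch_in_subtree[of "w @ [c]"] by (auto elim: arc_cases)

lemma prefix_closed:
  assumes "v \<in> pverts S" "prefix u v"
  shows "u \<in> pverts S"
proof (cases u rule: rev_cases)
  case Nil
  then show ?thesis using root_vert by simp
next
  case (snoc w c)
  then show ?thesis using branch_in_subtree[OF assms(1), of w c] assms(2) arc_iff by simp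
qed

lemma mem_leaves_iff: "v \<in> leaves S \<longleftrightarrow> v \<in> pverts S \<and> (\<forall>c. v @ [c] \<notin> pverts S)"
  by (simp add: leaves_def arc_iff)

lemma leaf_maximal:
  assumes "l \<in> leaves S" "v \<in> pverts S" "prefix l v"
  shows "v = l"
proof (rule ccontr)
  assume "v \<noteq> l"
  then obtain c r where "v = l @ c # r" using assms(3) by (metis append_Nil2 neq_Nil_conv prefixE)
  then have "prefix (l @ [c]) v" by simp
  then show False using prefix_closed assms mem_leaves_iff by blast
qed

lemma leaves_prefix_free:
  assumes "l \<in> leaves S" "l' \<in> leaves S" "prefix l v" "prefix l' v"
  shows "l = l'"
  using prefix_same_cases[OF assms(3,4)]
proof
  assume "prefix l l'"
  then show ?thesis using leaf_maximal[OF assms(1), of l'] assms(2) by (simp add: mem_leaves_iff)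
next
  assume "prefix l' l"
  then show ?thesis using leaf_maximal[OF assms(2), of l] assms(1) by (simp add: mem_leaves_iff)
qed

lemma root_not_leaf: "nontrivial S \<Longrightarrow> [] \<notin> leaves S"
proof
  assume "nontrivial S" "[] \<in> leaves S"
  then obtain u v where "(u, v) \<in> parcs S" by (auto simp: nontrivial_def)
  then obtain c where "v = u @ [c]" "v \<in> pverts S" by (rule arc_cases)
  then show False using leaf_maximal[OF \<open>[] \<in> leaves S\<close>, of v] by simp
qed

definition full :: bool where
  "full \<longleftrightarrow> (\<forall>v \<in> pverts S - leaves S. \<forall>d < p. v @ [d] \<in> pverts S)"

section \<open>Partitions of the $p$-adic integers\<close>

text \<open>
  The last vertex of \<open>S\<close> on the way along the digits of \<open>x\<close> misses a child, so by fullness it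
  is a leaf.
\<close>

lemma exit_through_leaf:
  assumes "full" "x \<in> padic_ints p" "digits p x n \<notin> pverts S"
  shows "\<exists>m<n. digits p x m \<in> leaves S"
proof -
  let ?P = "\<lambda>n. digits p x n \<notin> pverts S"
  define k where "k = (LEAST n. ?P n)"
  have k: "?P k" "k \<le> n"
    unfolding k_def using LeastI[of ?P, OF assms(3)] Least_le[of ?P, OF assms(3)] by simp_all
  then obtain m where m: "k = Suc m" using root_vert by (cases k) simp_all
  then have "digits p x m \<in> pverts S" using not_less_Least[of m ?P] by (auto simp: k_def)
  moreover obtain d where d: "digits p x k = digits p x m @ [d]"
    by (simp add: m digits_def)
  moreover have "d < p"
    using digits_of_padic_int[OF assms(2), of k] d by simp
  ultimately have "digits p x m \<in> leaves S"
    using assms(1) k(1) unfolding full_def by force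
  moreover have "m < n" using k(2) m by simp
  ultimately show ?thesis by blast
qed

lemma finite_full_imp_partition:
  assumes "1 < p" "finite (pverts S)" "full"
  shows "forms_partition (word_ball p) (leaves S) (padic_ints p)"
  unfolding forms_partition_def disjoint_family_on_def
proof (intro conjI ballI impI)
  have lw: "l \<in> words p" if "l \<in> leaves S" for l
    using that mem_leaves_iff verts_words by blast
  show "word_ball p l \<noteq> {}" if "l \<in> leaves S" for l
    using word_ball_nonempty[OF assms(1)] lw that by blast
  show "word_ball p l \<inter> word_ball p l' = {}" if "l \<in> leaves S" "l' \<in> leaves S" "l \<noteq> l'" for l l'
    using that lw word_balls_meet_imp_comparable[OF assms(1), of l l'] leaves_prefix_free[of l l']
    by blast
  show "(\<Union>l\<in>leaves S. word_ball p l) = padic_ints p"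
  proof (intro equalityI subsetI)
    fix x assume x: "x \<in> padic_ints p"
    obtain n where "\<forall>v\<in>pverts S. length v < n"
      using finite_nat_set_iff_bounded[of "length ` pverts S"] assms(2) by auto
    then have "digits p x n \<notin> pverts S" by auto
    then obtain m where "digits p x m \<in> leaves S" using exit_through_leaf assms(3) x by blast
    moreover from this have "x \<in> word_ball p (digits p x m)"
      using x lw mem_word_ball_iff[OF assms(1)] by auto
    ultimately show "x \<in> (\<Union>l\<in>leaves S. word_ball p l)" by blast
  qed (auto simp: word_ball_def padic_ball_def)
qed

text \<open>
  A leaf whose ball contains a point of the ball of the child \<open>v @ [d]\<close> is comparable with this child.  It
  is not a prefix of the inner vertex \<open>v\<close>, so it extends the child, which then is a vertex too.
\<close>

lemma cover_imp_full:
  assumes "1 < p" "padic_ints p \<subseteq> (\<Union>l\<in>leaves S. word_ball p l)"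
  shows "full"
  unfolding full_def
proof (intro ballI allI impI)
  fix v d assume v: "v \<in> pverts S - leaves S" and d: "d < p"
  have vw: "v @ [d] \<in> words p" using v d verts_words by auto
  then obtain x where x: "x \<in> word_ball p (v @ [d])" using word_ball_nonempty[OF assms(1)] by blast
  then have "x \<in> padic_ints p" by (simp add: word_ball_def padic_ball_def)
  then obtain l where l: "l \<in> leaves S" "x \<in> word_ball p l" using assms(2) by blast
  have "l \<in> words p" using l mem_leaves_iff verts_words by blast
  then have "prefix l (v @ [d]) \<or> prefix (v @ [d]) l"
    using word_balls_meet_imp_comparable assms(1) l(2) x vw by blast
  then have "prefix l v \<or> prefix (v @ [d]) l" by auto
  moreover have "\<not> prefix l v" using leaf_maximal[OF l(1), of v] v l(1) by blast
  ultimately show "v @ [d] \<in> pverts S" using prefix_closed l(1) mem_leaves_iff by blast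
qed

text \<open>
  An infinite subtree has an infinite branch by Koenig's lemma, and the digits along that branch form a
  $p$-adic integer.  A leaf whose ball contains it would lie on the branch, where every vertex has a child.
\<close>

lemma cover_imp_finite:
  assumes "1 < p" "padic_ints p \<subseteq> (\<Union>l\<in>leaves S. word_ball p l)"
  shows "finite (pverts S)"
proof (rule ccontr)
  assume inf: "infinite (pverts S)"
  \<comment> \<open>The branch follows vertices with infinitely many descendants.\<close>
  define above where "above v = {u \<in> pverts S. prefix v u}" for v
  have step: "\<exists>c. infinite (above (v @ [c]))" if "infinite (above v)" for v
  proof (rule ccontr)
    assume "\<nexists>c. infinite (above (v @ [c]))"
    then have "finite (insert v (\<Union>c<p. above (v @ [c])))" by simp
    moreover have "above v \<subseteq> insert v (\<Union>c<p. above (v @ [c]))"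
    proof
      fix u assume u: "u \<in> above v"
      then obtain r where r: "u = v @ r" by (auto simp: above_def elim: prefixE)
      show "u \<in> insert v (\<Union>c<p. above (v @ [c]))"
      proof (cases r)
        case (Cons c s)
        then have "c < p" using u r verts_words by (auto simp: above_def)
        then show ?thesis using u r Cons by (auto simp: above_def)
      qed (simp add: r)
    qed
    ultimately show False using that finite_subset by blast
  qed
  have "infinite (above [])" using inf by (simp add: above_def)
  then have "\<exists>f. \<forall>n. (infinite (above (f n)) \<and> length (f n) = n) \<and> (\<exists>c. f (Suc n) = f n @ [c])"
    using step
    by (intro dependent_nat_choice[of "\<lambda>n v. infinite (above v) \<and> length v = n"
        "\<lambda>n v v'. \<exists>c. v' = v @ [c]"]) (auto, fastforce)
  then obtain f where f_inf: "\<And>n. infinite (above (f n))" and f_len: "\<And>n. length (f n) = n"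
    and f_Suc: "\<And>n. \<exists>c. f (Suc n) = f n @ [c]" by blast
  have f_S: "f n \<in> pverts S" for n
  proof -
    have "above (f n) \<noteq> {}" using f_inf[of n] by auto
    then show ?thesis using prefix_closed by (auto simp: above_def)
  qed
  define x where "x n = int (word_value p (f n))" for n
  have x: "x \<in> padic_ints p"
    unfolding padic_ints_def
  proof (intro CollectI allI conjI)
    fix n
    have less: "word_value p (f n) < p ^ n"
      using word_value_less[of "f n" p] f_len[of n] f_S verts_words by auto
    then show "x n \<in> {0..<int p ^ n}" by (simp add: x_def flip: of_nat_power)
    obtain c where "f (Suc n) = f n @ [c]" using f_Suc by blast
    then show "x (Suc n) mod int p ^ n = x n"
      using less f_len[of n] by (simp add: x_def word_value_snoc flip: of_nat_power of_nat_mod)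
  qed
  then obtain l where l: "l \<in> leaves S" "x \<in> word_ball p l" using assms(2) by blast
  have lw: "l \<in> words p" using l(1) mem_leaves_iff verts_words by blast
  have "digits p x (length l) = l" using mem_word_ball_iff[OF assms(1) lw] l(2) by simp
  moreover have "digits p x (length l) = f (length l)"
    using digits_eq_iff[OF x, of "f (length l)"] f_len f_S verts_words by (auto simp: x_def)
  moreover obtain c where "f (Suc (length l)) = f (length l) @ [c]" using f_Suc by blast
  ultimately have "l @ [c] \<in> pverts S" using f_S[of "Suc (length l)"] by simp
  then show False using l(1) by (simp add: mem_leaves_iff)
qed

section \<open>Tilings\<close>

lemma arc_translate_iff:
  "(v, v @ [c]) \<in> parcs (translate w S) \<longleftrightarrow> (\<exists>s. v = w @ s \<and> s @ [c] \<in> pverts S)"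
proof
  assume "(v, v @ [c]) \<in> parcs (translate w S)"
  then obtain a b where "(a, b) \<in> parcs S" "v = w @ a" "v @ [c] = w @ b"
    by (auto simp: translate_def)
  then show "\<exists>s. v = w @ s \<and> s @ [c] \<in> pverts S" by (auto simp: arc_iff)
next
  assume "\<exists>s. v = w @ s \<and> s @ [c] \<in> pverts S"
  then obtain s where "v = w @ s" "(s, s @ [c]) \<in> parcs S" by (auto simp: arc_iff)
  then show "(v, v @ [c]) \<in> parcs (translate w S)" by (force simp: translate_def)
qed

lemma vert_translate_iff: "v \<in> pverts (translate w S) \<longleftrightarrow> (\<exists>s \<in> pverts S. v = w @ s)"
  by (auto simp: translate_def)

text \<open>
  Every translate in the tiling has all its root arcs, because \<open>S\<close> itself is among them and nothing else
  covers the arcs at the root.  Another translate whose root is an inner vertex of \<open>S\<close> thus shares an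
  arc with \<open>S\<close>.
\<close>

lemma tiling_imp_full:
  assumes "is_tiling p S \<Omega>"
  shows "full"
  unfolding full_def
proof (intro ballI allI impI)
  have verts_cover: "v \<in> words p \<Longrightarrow> \<exists>w\<in>\<Omega>. v \<in> pverts (translate w S)"
    and arcs_cover: "v \<in> words p \<Longrightarrow> c < p \<Longrightarrow> \<exists>w\<in>\<Omega>. (v, v @ [c]) \<in> parcs (translate w S)"
    for v c using assms by (auto simp: is_tiling_def word_tree_def)
  have disjoint: "w = w'" if "w \<in> \<Omega>" "w' \<in> \<Omega>" "e \<in> parcs (translate w S)" "e \<in> parcs (translate w' S)"
    for w w' e using assms that unfolding is_tiling_def by blast
  have root: "[] \<in> \<Omega>"
    using verts_cover[of "[]"] by (auto simp: vert_translate_iff)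
  have root_children: "[c] \<in> pverts S" if "c < p" for c
    using arcs_cover[of "[]" c] that by (auto simp: arc_translate_iff[of "[]", simplified])
  fix v d assume v: "v \<in> pverts S - leaves S" and d: "d < p"
  have vw: "v \<in> words p" using v verts_words by auto
  obtain c where c: "v @ [c] \<in> pverts S" using v mem_leaves_iff by blast
  obtain w s where w: "w \<in> \<Omega>" "v = w @ s" "s @ [d] \<in> pverts S"
    using arcs_cover[OF vw d] by (auto simp: arc_translate_iff)
  \<comment> \<open>The branch through \<open>v\<close> leaves \<open>w\<close> by an arc of \<open>S\<close> that is also a root arc of \<open>w S\<close>.\<close>
  obtain a r where a: "v @ [c] = w @ a # r" using w(2) by (cases s) auto
  then have wa: "w @ [a] \<in> pverts S" using prefix_closed[OF c, of "w @ [a]"] by simp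
  then have "a < p" using verts_words by auto
  then have "w = []"
    using disjoint[OF w(1) root, of "(w, w @ [a])"] wa root_children by (simp add: arc_translate_iff)
  then show "v @ [d] \<in> pverts S" using w by simp
qed

lemma nonleaf_or_leaf_prefix:
  assumes "full" "v \<in> words p"
  shows "v \<in> pverts S - leaves S \<or> (\<exists>l \<in> leaves S. prefix l v)"
  using assms(2)
proof (induction v rule: rev_induct)
  case Nil
  then show ?case using root_vert by auto
next
  case (snoc d v)
  then have "d < p" by simp
  consider "v \<in> pverts S - leaves S" | l where "l \<in> leaves S" "prefix l v"
    using snoc by auto
  then show ?case
  proof cases
    case 1
    then have "v @ [d] \<in> pverts S" using assms(1) \<open>d < p\<close> unfolding full_def by blast
    then show ?thesis by blast
  next
    case 2
    then have "prefix l (v @ [d])" by simp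
    then show ?thesis using 2(1) by blast
  qed
qed

text \<open>
  Concatenations of leaves are the places where a copy of \<open>S\<close> is to be attached: each copy is grown at a leaf
  of an earlier one.  As the root is no leaf, cutting off a leaf shortens a word, which makes the induction
  for covering work.
\<close>

lemma full_imp_tiling:
  assumes "nontrivial S" "finite (pverts S)" "full" "0 < p"
  shows "is_tiling p S (concat ` lists (leaves S))"
proof -
  let ?\<Omega> = "concat ` lists (leaves S)"
  have lw: "leaves S \<subseteq> words p" using mem_leaves_iff verts_words by blast
  have sub: "?\<Omega> \<subseteq> words p" using lw unfolding lists_eq_set by fastforce
  have arcs_cover: "\<exists>w\<in>?\<Omega>. (v, v @ [c]) \<in> parcs (translate w S)" if "v \<in> words p" "c < p" for v c
    using that(1)
  proof (induction v rule: length_induct)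
    case (1 v)
    from nonleaf_or_leaf_prefix[OF assms(3) \<open>v \<in> words p\<close>] show ?case
    proof
      assume "v \<in> pverts S - leaves S"
      then have "v @ [c] \<in> pverts S" using assms(3) that(2) by (auto simp: full_def)
      then have "(v, v @ [c]) \<in> parcs (translate (concat []) S)" by (simp add: arc_translate_iff)
      then show ?thesis by blast
    next
      assume "\<exists>l\<in>leaves S. prefix l v"
      then obtain l u where l: "l \<in> leaves S" "v = l @ u" by (auto elim: prefixE)
      moreover have "l \<noteq> []" using root_not_leaf assms(1) l(1) by blast
      ultimately have "length u < length v" "u \<in> words p" using 1 by auto
      then obtain ls where "ls \<in> lists (leaves S)" "(u, u @ [c]) \<in> parcs (translate (concat ls) S)"
        using 1 by blast
      moreover from this have "(v, v @ [c]) \<in> parcs (translate (concat (l # ls)) S)"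
        unfolding arc_translate_iff using l(2) by auto
      moreover have "l # ls \<in> lists (leaves S)" using calculation l(1) by simp
      ultimately show ?thesis by blast
    qed
  qed
  have verts_cover: "\<exists>w\<in>?\<Omega>. v \<in> pverts (translate w S)" if "v \<in> words p" for v
  proof -
    from arcs_cover[OF that assms(4)]
    obtain w s where "w \<in> ?\<Omega>" "v = w @ s" "s @ [0] \<in> pverts S"
      by (auto simp: arc_translate_iff)
    moreover from this have "s \<in> pverts S" using prefix_closed[of "s @ [0]" s] by simp
    ultimately show ?thesis using vert_translate_iff by blast
  qed
  \<comment> \<open>The leaves are a prefix code, and an inner vertex has no leaf as a prefix, so both factorizations
    agree leaf by leaf and end at the same point.\<close>
  have unique: "ls = ls'"
    if "concat ls @ s = concat ls' @ s'" "ls \<in> lists (leaves S)" "ls' \<in> lists (leaves S)"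
      "s @ [c] \<in> pverts S" "s' @ [c] \<in> pverts S" for ls ls' s s' c
    using that
  proof (induction ls arbitrary: ls')
    case Nil
    then show ?case
    proof (cases ls')
      case (Cons l' ms')
      then have "prefix l' (s @ [c])" "s @ [c] \<noteq> l'" "l' \<in> leaves S" using Nil by auto
      then show ?thesis using leaf_maximal Nil by blast
    qed simp
  next
    case (Cons l ms)
    show ?case
    proof (cases ls')
      case Nil
      then have "prefix l (s' @ [c])" "s' @ [c] \<noteq> l" "l \<in> leaves S"
        using Cons.prems by (auto simp flip: Cons.prems(1))
      then show ?thesis using leaf_maximal Cons.prems by blast
    next
      case (Cons l' ms')
      then have "l @ concat ms @ s = l' @ concat ms' @ s'" using Cons.prems by simp
      moreover have "l = l'"
      proof (rule leaves_prefix_free)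
        show "prefix l (l @ concat ms @ s)" by simp
        show "prefix l' (l @ concat ms @ s)" unfolding calculation by simp
      qed (use Cons.prems(2,3) Cons in auto)
      ultimately show ?thesis using Cons Cons.prems Cons.IH[of ms'] by auto
    qed
  qed
  have disjoint: "parcs (translate w S) \<inter> parcs (translate w' S) = {}"
    if "w \<in> ?\<Omega>" "w' \<in> ?\<Omega>" "w \<noteq> w'" for w w'
  proof (rule ccontr)
    assume "parcs (translate w S) \<inter> parcs (translate w' S) \<noteq> {}"
    then obtain u v where e: "(u, v) \<in> parcs (translate w S)" "(u, v) \<in> parcs (translate w' S)" by auto
    then obtain c where v: "v = u @ [c]" by (auto simp: translate_def elim: arc_cases)
    obtain ls ls' where ls: "w = concat ls" "ls \<in> lists (leaves S)"
      and ls': "w' = concat ls'" "ls' \<in> lists (leaves S)"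
      using \<open>w \<in> ?\<Omega>\<close> \<open>w' \<in> ?\<Omega>\<close> by blast
    obtain s where s: "u = concat ls @ s" "s @ [c] \<in> pverts S"
      using e(1) unfolding v ls(1) arc_translate_iff by blast
    obtain s' where s': "u = concat ls' @ s'" "s' @ [c] \<in> pverts S"
      using e(2) unfolding v ls'(1) arc_translate_iff by blast
    have "concat ls @ s = concat ls' @ s'" using s(1) s'(1) by metis
    then have "ls = ls'" using ls(2) ls'(2) s(2) s'(2) by (rule unique)
    then show False using \<open>w \<noteq> w'\<close> ls(1) ls'(1) by simp
  qed
  have "\<forall>e \<in> parcs (word_tree p). \<exists>w \<in> ?\<Omega>. e \<in> parcs (translate w S)"
  proof
    fix e assume "e \<in> parcs (word_tree p)"
    then obtain v c where "e = (v, v @ [c])" "v \<in> words p" "c < p" by (auto simp: word_tree_def)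
    then show "\<exists>w \<in> ?\<Omega>. e \<in> parcs (translate w S)" using arcs_cover by blast
  qed
  moreover have "\<forall>v \<in> pverts (word_tree p). \<exists>w \<in> ?\<Omega>. v \<in> pverts (translate w S)"
    using verts_cover by (simp add: word_tree_def)
  ultimately show ?thesis
    unfolding is_tiling_def using subtree assms(1,2) sub disjoint by blast
qed

end

theorem theorem3p4:
  fixes p :: nat and S :: "nat list pair_pre_digraph"
  assumes "prime p"
    and "is_subtree p S" and "nontrivial S" and "rooted S"
  shows "(\<exists>\<Omega>. is_tiling p S \<Omega>) \<longleftrightarrow> forms_partition (word_ball p) (leaves S) (padic_ints p)"
proof -
  interpret rooted_subtree p S using assms by unfold_locales
  have p: "1 < p" using assms(1) prime_gt_1_nat by simp
  show ?thesis
  proof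
    assume "\<exists>\<Omega>. is_tiling p S \<Omega>"
    then have "finite (pverts S)" and full using tiling_imp_full by (auto simp: is_tiling_def)
    then show "forms_partition (word_ball p) (leaves S) (padic_ints p)"
      using finite_full_imp_partition p by blast
  next
    assume "forms_partition (word_ball p) (leaves S) (padic_ints p)"
    then have "padic_ints p \<subseteq> (\<Union>l\<in>leaves S. word_ball p l)" by (simp add: forms_partition_def)
    then have "finite (pverts S)" and full using cover_imp_finite cover_imp_full p by blast+
    then show "\<exists>\<Omega>. is_tiling p S \<Omega>" using full_imp_tiling assms(3) p by auto
  qed
qed

end
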